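(* Let $A,B,C$ be complex vector spaces of dimension $m$ and let $T\in A\otimes B\otimes C=\mathbb{C}^m\otimes\mathbb{C}^m\otimes\mathbb{C}^m$ be $1_A$- and $1_B$-generic and satisfy the $A$-Strassen equations. Then $T$ is isomorphic to a tensor in $S^2\mathbb{C}^m\otimes\mathbb{C}^m$. In particular: (1) After making choices of general $\alpha\in A^*$ and $\beta\in B^*$, $T(A^* )$ and $T(B^* )$ are $GL_m$-isomorphic subspaces of $\mathrm{End}(\mathbb{C}^m)$; that is, the subspaces $T(A^* )T(\alpha)^{-1}\subset\mathrm{End}(B)$ and $T(B^* )T(\beta)^{-1}\subset\mathrm{End}(A)$ correspond to each other under a linear isomorphism $A\simeq B$. (2) If $T$ is $1$-generic, then $T$ is isomorphic to a tensor in $S^3\mathbb{C}^m$.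
   Context: A tensor $T\in A\otimes B\otimes C$ is viewed as a linear map $T:A^*\to B\otimes C\simeq\mathrm{Hom}(C^*,B)$, and likewise as $T:B^*\to A\otimes C\simeq\mathrm{Hom}(C^*,A)$ and $T:C^*\to A\otimes B$. $T$ is $1_A$-generic if some $T(\alpha)$, $\alpha\in A^*$, has rank $m$; $1_B$- and $1_C$-generic are defined similarly; $T$ is $1$-generic if it is $1_A$-, $1_B$- and $1_C$-generic. A $1_A$-generic $T$ satisfies the $A$-Strassen equations (for border rank $m$) if for all $\alpha,\alpha_1,\alpha_2\in A^*$ with $T(\alpha)$ invertible, $T(\alpha_1)T(\alpha)^{-1}$ and $T(\alpha_2)T(\alpha)^{-1}$ commute in $\mathrm{End}(B)$. Two tensors $T,T'$ in $\mathbb{C}^m\otimes\mathbb{C}^m\otimes\mathbb{C}^m$ are isomorphic if $\sigma(g(T))=T'$ for some $g\in GL(A)\times GL(B)\times GL(C)$ and some permutation $\sigma\in\mathfrak{S}_3$ of the factors (with the three factors identified with $\mathbb{C}^m$). $S^kV\subset V^{\otimes k}$ denotes symmetric tensors. *)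

theory Defs
  imports "HOL-Analysis.Analysis" "HOL-Combinatorics.Permutations"
begin

text \<open>
  With \<open>CARD('n) = m\<close>, a tensor in \<open>A \<otimes> B \<otimes> C = \<complex>\<^sup>m \<otimes> \<complex>\<^sup>m \<otimes> \<complex>\<^sup>m\<close> is given by its
  coordinates \<open>T $ a $ b $ c\<close>, and covectors by their coordinates in the dual basis.
\<close>

type_synonym 'n tensor3 = "complex ^ 'n ^ 'n ^ 'n"

text \<open>
  \<open>flatten_A T \<alpha>\<close> is the matrix of \<open>T(\<alpha>) : C\<^sup>* \<rightarrow> B\<close> (rows indexed by \<open>B\<close>, columns by \<open>C\<close>),
  \<open>flatten_B T \<beta>\<close> that of \<open>T(\<beta>) : C\<^sup>* \<rightarrow> A\<close> (rows \<open>A\<close>, columns \<open>C\<close>), and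
  \<open>flatten_C T \<gamma>\<close> that of \<open>T(\<gamma>) \<in> A \<otimes> B\<close> (rows \<open>A\<close>, columns \<open>B\<close>).
\<close>

definition flatten_A :: "'n::finite tensor3 \<Rightarrow> complex ^ 'n \<Rightarrow> complex ^ 'n ^ 'n" where
  "flatten_A T \<alpha> = (\<chi> b c. \<Sum>a\<in>UNIV. \<alpha> $ a * T $ a $ b $ c)"

definition flatten_B :: "'n::finite tensor3 \<Rightarrow> complex ^ 'n \<Rightarrow> complex ^ 'n ^ 'n" where
  "flatten_B T \<beta> = (\<chi> a c. \<Sum>b\<in>UNIV. \<beta> $ b * T $ a $ b $ c)"

definition flatten_C :: "'n::finite tensor3 \<Rightarrow> complex ^ 'n \<Rightarrow> complex ^ 'n ^ 'n" where
  "flatten_C T \<gamma> = (\<chi> a b. \<Sum>c\<in>UNIV. \<gamma> $ c * T $ a $ b $ c)"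

definition one_A_generic :: "'n::finite tensor3 \<Rightarrow> bool" where
  "one_A_generic T \<longleftrightarrow> (\<exists>\<alpha>. rank (flatten_A T \<alpha>) = CARD('n))"

definition one_B_generic :: "'n::finite tensor3 \<Rightarrow> bool" where
  "one_B_generic T \<longleftrightarrow> (\<exists>\<beta>. rank (flatten_B T \<beta>) = CARD('n))"

definition one_C_generic :: "'n::finite tensor3 \<Rightarrow> bool" where
  "one_C_generic T \<longleftrightarrow> (\<exists>\<gamma>. rank (flatten_C T \<gamma>) = CARD('n))"

definition one_generic :: "'n::finite tensor3 \<Rightarrow> bool" where
  "one_generic T \<longleftrightarrow> one_A_generic T \<and> one_B_generic T \<and> one_C_generic T"

definition A_Strassen :: "'n::finite tensor3 \<Rightarrow> bool" where
  "A_Strassen T \<longleftrightarrow> (\<forall>\<alpha> \<alpha>1 \<alpha>2. invertible (flatten_A T \<alpha>) \<longrightarrow>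
     (let X = flatten_A T \<alpha>1 ** matrix_inv (flatten_A T \<alpha>);
          Y = flatten_A T \<alpha>2 ** matrix_inv (flatten_A T \<alpha>)
      in X ** Y = Y ** X))"

text \<open>
  The subspaces \<open>T(A\<^sup>*) T(\<alpha>)\<inverse> \<subseteq> End(B)\<close> and \<open>T(B\<^sup>*) T(\<beta>)\<inverse> \<subseteq> End(A)\<close>; they are
  meaningful only if \<open>T(\<alpha>)\<close>, respectively \<open>T(\<beta>)\<close>, is invertible.
\<close>

definition End_space_A :: "'n::finite tensor3 \<Rightarrow> complex ^ 'n \<Rightarrow> (complex ^ 'n ^ 'n) set" where
  "End_space_A T \<alpha> = {flatten_A T \<alpha>' ** matrix_inv (flatten_A T \<alpha>) | \<alpha>'. True}"

definition End_space_B :: "'n::finite tensor3 \<Rightarrow> complex ^ 'n \<Rightarrow> (complex ^ 'n ^ 'n) set" where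
  "End_space_B T \<beta> = {flatten_B T \<beta>' ** matrix_inv (flatten_B T \<beta>) | \<beta>'. True}"

definition GL_act :: "complex ^ 'n ^ 'n \<Rightarrow> complex ^ 'n ^ 'n \<Rightarrow> complex ^ 'n ^ 'n
    \<Rightarrow> 'n::finite tensor3 \<Rightarrow> 'n tensor3" where
  "GL_act g h k T = (\<chi> a b c. \<Sum>a'\<in>UNIV. \<Sum>b'\<in>UNIV. \<Sum>c'\<in>UNIV.
     g $ a $ a' * h $ b $ b' * k $ c $ c' * T $ a' $ b' $ c')"

text \<open>The three factors are numbered \<open>0, 1, 2\<close>.\<close>

definition permute_factors :: "(nat \<Rightarrow> nat) \<Rightarrow> 'n::finite tensor3 \<Rightarrow> 'n tensor3" where
  "permute_factors \<sigma> T = (\<chi> a b c. let i = (!) [a, b, c] in T $ i (\<sigma> 0) $ i (\<sigma> 1) $ i (\<sigma> 2))"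

definition tensor_isomorphic :: "'n::finite tensor3 \<Rightarrow> 'n tensor3 \<Rightarrow> bool" where
  "tensor_isomorphic T T' \<longleftrightarrow> (\<exists>g h k \<sigma>. invertible g \<and> invertible h \<and> invertible k \<and>
     \<sigma> permutes {..<3} \<and> permute_factors \<sigma> (GL_act g h k T) = T')"

definition S2 :: "(complex ^ 'n ^ 'n) set" where
  "S2 = {s. transpose s = s}"

definition S3 :: "('n::finite tensor3) set" where
  "S3 = {T. \<forall>\<sigma>. \<sigma> permutes {..<3} \<longrightarrow> permute_factors \<sigma> T = T}"

definition tensor_prod :: "complex ^ 'n ^ 'n \<Rightarrow> complex ^ 'n \<Rightarrow> 'n::finite tensor3" where
  "tensor_prod s v = (\<chi> a b c. s $ a $ b * v $ c)"

text \<open>\<open>S\<^sup>2\<complex>\<^sup>m \<otimes> \<complex>\<^sup>m\<close> as a subspace of \<open>\<complex>\<^sup>m \<otimes> \<complex>\<^sup>m \<otimes> \<complex>\<^sup>m\<close>: finite sums of \<open>s \<otimes> v\<close>.\<close>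

definition S2_tensor_V :: "('n::finite tensor3) set" where
  "S2_tensor_V = {\<Sum>i<r. tensor_prod (s i) (v i) | (r :: nat) s v. \<forall>i<r. s i \<in> S2}"

lemma S2_tensor_V_iff:
  fixes T :: "'n::finite tensor3"
  shows "T \<in> S2_tensor_V \<longleftrightarrow> (\<forall>a b c. T $ a $ b $ c = T $ b $ a $ c)"
proof
  assume "T \<in> S2_tensor_V"
  then obtain r :: nat and s v where T: "T = (\<Sum>i<r. tensor_prod (s i) (v i))"
    and s: "\<forall>i<r. s i \<in> S2"
    by (auto simp: S2_tensor_V_def)
  have "s i $ a $ b = s i $ b $ a" if "i < r" for i a b
  proof -
    have "transpose (s i) $ a $ b = s i $ a $ b"
      using s that by (simp add: S2_def)
    then show ?thesis
      by (simp add: transpose_def)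
  qed
  then show "\<forall>a b c. T $ a $ b $ c = T $ b $ a $ c"
    by (auto simp: T tensor_prod_def intro!: sum.cong)
next
  assume sym: "\<forall>a b c. T $ a $ b $ c = T $ b $ a $ c"
  obtain f :: "nat \<Rightarrow> 'n" where f: "bij_betw f {..<CARD('n)} UNIV"
    using ex_bij_betw_nat_finite[of "UNIV :: 'n set"] by (auto simp: atLeast0LessThan)
  define s where "s i = (\<chi> a b. T $ a $ b $ f i)" for i
  define v :: "nat \<Rightarrow> complex ^ 'n" where "v i = axis (f i) 1" for i
  have "T $ a $ b $ c = (\<Sum>i<CARD('n). tensor_prod (s i) (v i)) $ a $ b $ c" for a b c
  proof -
    have "(\<Sum>i<CARD('n). tensor_prod (s i) (v i)) $ a $ b $ c
        = (\<Sum>i<CARD('n). (\<lambda>d. if c = d then T $ a $ b $ d else 0) (f i))"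
      by (auto simp: tensor_prod_def s_def v_def axis_def intro!: sum.cong)
    also have "\<dots> = (\<Sum>d\<in>UNIV. if c = d then T $ a $ b $ d else 0)"
      by (rule sum.reindex_bij_betw[OF f])
    also have "\<dots> = T $ a $ b $ c"
      by simp
    finally show ?thesis ..
  qed
  then have "T = (\<Sum>i<CARD('n). tensor_prod (s i) (v i))"
    by (simp add: vec_eq_iff)
  moreover have "\<forall>i<CARD('n). s i \<in> S2"
    using sym by (simp add: S2_def s_def transpose_def vec_eq_iff)
  ultimately show "T \<in> S2_tensor_V"
    unfolding S2_tensor_V_def by blast
qed

end

theory Submission imports Defs begin

text \<open>
  Let \<open>M = T(\<alpha>)\<close> and \<open>N = T(\<beta>)\<close> be invertible and put \<open>h = N M\<inverse> : B \<rightarrow> A\<close>.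
  Writing \<open>T\<^sub>a\<close> for the slices of \<open>T\<close> in the \<open>A\<close> direction, row \<open>a\<close> of \<open>N\<close> is \<open>\<beta>\<^sup>t T\<^sub>a\<close>, so row \<open>a\<close>
  of \<open>h T\<^sub>d\<close> is \<open>\<beta>\<^sup>t T\<^sub>a M\<inverse> T\<^sub>d\<close>, which is symmetric in \<open>a\<close>, \<open>d\<close> by the Strassen equations. Hence
  applying \<open>h\<close> to the factor \<open>B\<close> gives a tensor \<open>S\<close> that is symmetric in its first two indices,
  and conjugation by \<open>h\<close> carries \<open>T(A\<^sup>*) M\<inverse>\<close> to \<open>T(B\<^sup>*) N\<inverse>\<close>. The slices of \<open>S\<close> satisfy
  \<open>S\<^sub>a N\<inverse> S\<^sub>d = S\<^sub>d N\<inverse> S\<^sub>a\<close>; contracting the third index of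
  \<open>(S\<^sub>a N\<inverse> S\<^sub>d)\<^sub>b\<^sub>c\<close> with \<open>\<gamma>\<close> such that \<open>T(\<gamma>)\<close> is invertible gives a tensor in the indices
  \<open>a, b, d\<close> that is isomorphic to \<open>S\<close> and has both the symmetry in \<open>a\<close>, \<open>b\<close> and that in \<open>a\<close>, \<open>d\<close>.
\<close>

section \<open>Invertible matrices over a field\<close>

lemma matrix_inv_works:
  assumes "invertible A"
  shows matrix_mul_matrix_inv: "A ** matrix_inv A = mat 1"
    and matrix_inv_mul_matrix: "matrix_inv A ** A = mat 1"
  using assms someI_ex[of "\<lambda>B. A ** B = mat 1 \<and> B ** A = mat 1"]
  unfolding invertible_def matrix_inv_def by blast+

lemma matrix_inv_eqI:
  fixes A :: "'a::field ^ 'n ^ 'n"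
  assumes "A ** B = mat 1"
  shows "matrix_inv A = B"
proof -
  have "invertible A"
    using assms invertible_right_inverse by blast
  then show ?thesis
    by (metis assms matrix_inv_mul_matrix matrix_mul_assoc matrix_mul_lid matrix_mul_rid)
qed

lemma invertible_matrix_inv:
  "invertible A \<Longrightarrow> invertible (matrix_inv A)"
  using matrix_inv_works[of A] unfolding invertible_def by blast

lemma matrix_inv_matrix_inv:
  fixes A :: "'a::field ^ 'n ^ 'n"
  shows "invertible A \<Longrightarrow> matrix_inv (matrix_inv A) = A"
  by (simp add: matrix_inv_eqI matrix_inv_mul_matrix)

lemma matrix_inv_mult:
  fixes A B :: "'a::field ^ 'n ^ 'n"
  assumes "invertible A" and "invertible B"
  shows "matrix_inv (A ** B) = matrix_inv B ** matrix_inv A"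
  by (rule matrix_inv_eqI)
    (metis assms matrix_mul_matrix_inv matrix_mul_assoc matrix_mul_rid)

lemma invertible_transpose:
  fixes A :: "'a::field ^ 'n ^ 'n"
  shows "invertible A \<Longrightarrow> invertible (transpose A)"
  by (meson invertible_def left_invertible_transpose matrix_left_right_inverse)

text \<open>Turns the rank conditions of genericity into invertibility: full rank makes the rows
  span, which yields a left inverse.\<close>

lemma full_rank_imp_invertible:
  fixes A :: "'a::field ^ 'n ^ 'n"
  assumes "rank A = CARD('n)"
  shows "invertible A"
proof -
  have "vec.span (rows A) = UNIV"
    using assms unfolding row_rank_def_gen
    by (metis vec.dim_eq_full vec.span_UNIV vec_dim_card)
  then show ?thesis
    by (simp add: invertible_left_inverse matrix_left_invertible_span_rows_gen)
qed

lemma matrix_mult_nth: "(A ** B) $ i = A $ i v* B"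
  by (simp add: matrix_matrix_mult_def vector_matrix_mult_def vec_eq_iff)

section \<open>Slices of a tensor\<close>

lemma flatten_A_axis: "flatten_A T (axis a 1) = T $ a"
  by (simp add: flatten_A_def axis_def vec_eq_iff if_distrib if_distribR cong: if_cong)

lemma flatten_B_nth: "flatten_B T \<beta> $ a = \<beta> v* T $ a"
  by (simp add: flatten_B_def vector_matrix_mult_def vec_eq_iff)

lemma matrix_mult_flatten_A:
  "h ** flatten_A T \<alpha> = flatten_A (\<chi> a. h ** T $ a) \<alpha>"
proof -
  have "(\<Sum>i\<in>UNIV. h $ b $ i * (\<Sum>a\<in>UNIV. \<alpha> $ a * T $ a $ i $ c))
      = (\<Sum>a\<in>UNIV. \<alpha> $ a * (\<Sum>i\<in>UNIV. h $ b $ i * T $ a $ i $ c))" for b c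
    unfolding sum_distrib_left by (subst sum.swap) (simp add: ac_simps)
  then show ?thesis
    by (simp add: flatten_A_def matrix_matrix_mult_def vec_eq_iff)
qed

lemma flatten_C_slice_mult:
  "flatten_C (\<chi> a. h ** T $ a) \<gamma> = flatten_C T \<gamma> ** transpose h"
proof -
  have "(\<Sum>c\<in>UNIV. \<gamma> $ c * (\<Sum>i\<in>UNIV. h $ b $ i * T $ a $ i $ c))
      = (\<Sum>i\<in>UNIV. (\<Sum>c\<in>UNIV. \<gamma> $ c * T $ a $ i $ c) * h $ b $ i)" for a b
    unfolding sum_distrib_left sum_distrib_right by (subst sum.swap) (simp add: ac_simps)
  then show ?thesis
    by (simp add: flatten_C_def matrix_matrix_mult_def transpose_def vec_eq_iff)
qed

lemma GL_act_mat_1: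
  "GL_act (mat 1) h k T = (\<chi> a. h ** T $ a ** transpose k)"
proof -
  have "(\<Sum>a'\<in>UNIV. \<Sum>b'\<in>UNIV. \<Sum>c'\<in>UNIV.
        mat 1 $ a $ a' * h $ b $ b' * k $ c $ c' * T $ a' $ b' $ c')
      = (\<Sum>a'\<in>UNIV. if a = a' then \<Sum>b'\<in>UNIV. \<Sum>c'\<in>UNIV.
        h $ b $ b' * k $ c $ c' * T $ a' $ b' $ c' else 0)" for a b c
    by (intro sum.cong refl) (auto simp: mat_def)
  moreover have "(\<Sum>b'\<in>UNIV. \<Sum>c'\<in>UNIV. h $ b $ b' * k $ c $ c' * T $ a $ b' $ c')
      = (\<Sum>c'\<in>UNIV. (\<Sum>b'\<in>UNIV. h $ b $ b' * T $ a $ b' $ c') * k $ c $ c')" for a b c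
    unfolding sum_distrib_right by (subst sum.swap) (simp add: ac_simps)
  ultimately show ?thesis
    by (simp add: GL_act_def matrix_matrix_mult_def transpose_def vec_eq_iff)
qed

text \<open>The only isomorphisms used below: the first factor stays fixed and nothing is permuted.
  The group acts on the third index from the left, hence \<open>transpose k\<close> in the
  witness.\<close>

lemma tensor_isomorphic_slice_mult:
  assumes "invertible h" and "invertible k"
  shows "tensor_isomorphic T (\<chi> a. h ** T $ a ** k)"
proof -
  have "permute_factors id (GL_act (mat 1) h (transpose k) T) = (\<chi> a. h ** T $ a ** k)"
    by (simp add: GL_act_mat_1 permute_factors_def vec_eq_iff)
  moreover have "invertible (mat 1 :: complex ^ 'a ^ 'a)"
    unfolding invertible_def using matrix_mul_lid by blast
  ultimately show ?thesis
    unfolding tensor_isomorphic_def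
    using assms invertible_transpose permutes_id by metis
qed

text \<open>Two transpositions generate the symmetric group on the three factors.\<close>

lemma S3_I:
  assumes sym12: "\<And>a b c. T $ a $ b $ c = T $ b $ a $ c"
    and sym13: "\<And>a b c. T $ a $ b $ c = T $ c $ b $ a"
  shows "T \<in> S3"
proof -
  have "permute_factors \<sigma> T $ a $ b $ c = T $ a $ b $ c" if \<sigma>: "\<sigma> permutes {..<3}" for \<sigma> a b c
  proof -
    have "\<sigma> i < 3" if "i < 3" for i
      using permutes_in_image[OF \<sigma>, of i] that by simp
    then have "\<sigma> 0 < 3" "\<sigma> 1 < 3" "\<sigma> 2 < 3"
      by simp_all
    then have "\<sigma> 0 \<in> {0, 1, 2}" "\<sigma> 1 \<in> {0, 1, 2}" "\<sigma> 2 \<in> {0, 1, 2}"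
      by auto
    moreover have "\<sigma> 0 \<noteq> \<sigma> 1" "\<sigma> 0 \<noteq> \<sigma> 2" "\<sigma> 1 \<noteq> \<sigma> 2"
      by (simp_all add: inj_eq[OF permutes_inj[OF \<sigma>]])
    moreover have "T $ b $ a $ c = T $ a $ b $ c" "T $ c $ b $ a = T $ a $ b $ c"
      "T $ b $ c $ a = T $ a $ b $ c" "T $ c $ a $ b = T $ a $ b $ c" "T $ a $ c $ b = T $ a $ b $ c"
      using sym12[of a b c] sym13[of a b c] sym12[of c b a] sym13[of b a c] sym12[of c a b]
      by simp_all
    ultimately show ?thesis
      by (auto simp: permute_factors_def)
  qed
  then show ?thesis
    by (simp add: S3_def vec_eq_iff)
qed

section \<open>Symmetry from the Strassen equations\<close>

lemma A_Strassen_slices: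
  assumes "A_Strassen T" and inv: "invertible (flatten_A T \<alpha>)"
  shows "T $ a ** matrix_inv (flatten_A T \<alpha>) ** T $ d
    = T $ d ** matrix_inv (flatten_A T \<alpha>) ** T $ a"
proof -
  let ?K = "matrix_inv (flatten_A T \<alpha>)"
  have "(T $ a ** ?K) ** (T $ d ** ?K) = (T $ d ** ?K) ** (T $ a ** ?K)"
    using assms unfolding A_Strassen_def Let_def by (metis flatten_A_axis)
  \<comment> \<open>Right multiplication by \<open>flatten_A T \<alpha>\<close> cancels the last
    \<open>?K\<close> on each side.\<close>
  then have "T $ a ** ?K ** T $ d ** ?K ** flatten_A T \<alpha>
      = T $ d ** ?K ** T $ a ** ?K ** flatten_A T \<alpha>"
    by (simp add: matrix_mul_assoc)
  then show ?thesis
    by (simp add: matrix_mul_assoc[symmetric] matrix_inv_mul_matrix[OF inv])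
qed

definition transfer :: "'n::finite tensor3 \<Rightarrow> complex ^ 'n \<Rightarrow> complex ^ 'n \<Rightarrow> complex ^ 'n ^ 'n"
  where "transfer T \<alpha> \<beta> = flatten_B T \<beta> ** matrix_inv (flatten_A T \<alpha>)"

lemma invertible_transfer:
  "invertible (flatten_A T \<alpha>) \<Longrightarrow> invertible (flatten_B T \<beta>) \<Longrightarrow> invertible (transfer T \<alpha> \<beta>)"
  by (simp add: transfer_def invertible_mult invertible_matrix_inv)

lemma transfer_flatten_A:
  "invertible (flatten_A T \<alpha>) \<Longrightarrow> transfer T \<alpha> \<beta> ** flatten_A T \<alpha> = flatten_B T \<beta>"
  by (simp add: transfer_def matrix_mul_assoc[symmetric] matrix_inv_mul_matrix)

lemma transfer_symmetric:
  assumes "A_Strassen T" and "invertible (flatten_A T \<alpha>)"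
  shows "(transfer T \<alpha> \<beta> ** T $ a) $ d = (transfer T \<alpha> \<beta> ** T $ d) $ a"
proof -
  have "(transfer T \<alpha> \<beta> ** T $ a) $ d = \<beta> v* (T $ d ** matrix_inv (flatten_A T \<alpha>) ** T $ a)"
    for a d
    by (simp add: transfer_def matrix_mult_nth flatten_B_nth vector_matrix_mul_assoc)
  then show ?thesis
    by (simp add: A_Strassen_slices[OF assms])
qed

text \<open>Row \<open>d\<close> of the left side combines the rows of
  \<open>transfer T \<alpha> \<beta> ** T $ d\<close> with coefficients \<alpha>'. By
  \<open>transfer_symmetric\<close>, row \<open>a\<close> of that matrix is row \<open>d\<close> of
  \<open>transfer T \<alpha> \<beta> ** T $ a\<close>.\<close>

lemma flatten_B_transfer:
  assumes "A_Strassen T" and "invertible (flatten_A T \<alpha>)"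
  shows "flatten_B T (\<alpha>' v* transfer T \<alpha> \<beta>) = transfer T \<alpha> \<beta> ** flatten_A T \<alpha>'"
proof -
  have "flatten_B T (\<alpha>' v* transfer T \<alpha> \<beta>) $ d = (transfer T \<alpha> \<beta> ** flatten_A T \<alpha>') $ d" for d
  proof -
    have "flatten_B T (\<alpha>' v* transfer T \<alpha> \<beta>) $ d = \<alpha>' v* (transfer T \<alpha> \<beta> ** T $ d)"
      by (simp add: flatten_B_nth vector_matrix_mul_assoc)
    also have "\<dots> = (\<chi> c. \<Sum>a\<in>UNIV. \<alpha>' $ a * (transfer T \<alpha> \<beta> ** T $ a) $ d $ c)"
      by (simp add: vector_matrix_mult_def transfer_symmetric[OF assms, of _ _ d])
    also have "\<dots> = (transfer T \<alpha> \<beta> ** flatten_A T \<alpha>') $ d"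
      by (simp add: matrix_mult_flatten_A) (simp add: flatten_A_def)
    finally show ?thesis .
  qed
  then show ?thesis
    by (simp add: vec_eq_iff)
qed

lemma End_space_B_conjugate:
  assumes strassen: "A_Strassen T"
    and inv_A: "invertible (flatten_A T \<alpha>)" and inv_B: "invertible (flatten_B T \<beta>)"
  defines "h \<equiv> transfer T \<alpha> \<beta>"
  shows "End_space_B T \<beta> = {h ** X ** matrix_inv h | X. X \<in> End_space_A T \<alpha>}"
proof -
  have inv_h: "invertible h"
    unfolding h_def using inv_A inv_B by (rule invertible_transfer)
  have inv_N: "matrix_inv (flatten_B T \<beta>) = matrix_inv (flatten_A T \<alpha>) ** matrix_inv h"
    using matrix_inv_mult[OF inv_h inv_A] transfer_flatten_A[OF inv_A] by (simp add: h_def)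
  have conj: "flatten_B T (\<alpha>' v* h) ** matrix_inv (flatten_B T \<beta>)
      = h ** (flatten_A T \<alpha>' ** matrix_inv (flatten_A T \<alpha>)) ** matrix_inv h" for \<alpha>'
    using flatten_B_transfer[OF strassen inv_A] by (simp add: inv_N matrix_mul_assoc h_def)
  \<comment> \<open>As \<open>h\<close> is invertible, the covectors \<open>\<alpha>' v* h\<close>
    exhaust the dual of B, so \<open>conj\<close> reaches the whole space.\<close>
  have surj: "\<beta>' = (\<beta>' v* matrix_inv h) v* h" for \<beta>'
    by (simp add: vector_matrix_mul_assoc matrix_inv_mul_matrix[OF inv_h])
  have "End_space_B T \<beta> = {flatten_B T (\<alpha>' v* h) ** matrix_inv (flatten_B T \<beta>) | \<alpha>'. True}"
    unfolding End_space_B_def using surj by metis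
  then show ?thesis
    unfolding conj End_space_A_def by blast
qed

text \<open>Right multiplication of the slices touches only the third index, so \<open>sym\<close>
  survives. Column \<open>d\<close> of \<open>flatten_C S \<gamma>\<close> is
  \<open>S $ d *v \<gamma>\<close>, so \<open>comm\<close> lets the outer indices be
  exchanged.\<close>

lemma symmetric_slices_S3:
  assumes sym: "\<And>a b c. S $ a $ b $ c = S $ b $ a $ c"
    and comm: "\<And>a d. S $ a ** K ** S $ d = S $ d ** K ** S $ a"
  shows "(\<chi> a. S $ a ** (K ** flatten_C S \<gamma>)) \<in> S3"
proof (rule S3_I)
  let ?U = "\<chi> a. S $ a ** (K ** flatten_C S \<gamma>)"
  have flat: "flatten_C S \<gamma> $ i $ d = (S $ d *v \<gamma>) $ i" for i d
    by (simp add: flatten_C_def matrix_vector_mult_def sym[of i d] mult.commute)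
  have U: "?U $ a $ b $ d = ((S $ a ** K ** S $ d) *v \<gamma>) $ b" for a b d
  proof -
    have "?U $ a $ b $ d = (S $ a ** K ** flatten_C S \<gamma>) $ b $ d"
      by (simp add: matrix_mul_assoc)
    also have "\<dots> = (\<Sum>i\<in>UNIV. (S $ a ** K) $ b $ i * (S $ d *v \<gamma>) $ i)"
      by (simp add: matrix_matrix_mult_def[of "S $ a ** K"] flat)
    also have "\<dots> = ((S $ a ** K) *v (S $ d *v \<gamma>)) $ b"
      by (simp add: matrix_vector_mult_def[of "S $ a ** K"])
    finally show ?thesis
      by (simp add: matrix_vector_mul_assoc)
  qed
  show "?U $ a $ b $ d = ?U $ d $ b $ a" for a b d
    unfolding U comm[of a d] ..
  show "?U $ a $ b $ d = ?U $ b $ a $ d" for a b d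
    by (simp add: matrix_matrix_mult_def[of "S $ _"] sym[of a b])
qed

theorem proposition5p8:
  fixes T :: "'n::finite tensor3"
  assumes "one_A_generic T" and "one_B_generic T" and "A_Strassen T"
  shows "(\<exists>T' \<in> S2_tensor_V. tensor_isomorphic T T')
    \<and> (\<forall>\<alpha> \<beta>. invertible (flatten_A T \<alpha>) \<and> invertible (flatten_B T \<beta>) \<longrightarrow>
         (\<exists>P :: complex ^ 'n ^ 'n. invertible P \<and>
            End_space_B T \<beta> = {matrix_inv P ** X ** P | X. X \<in> End_space_A T \<alpha>}))
    \<and> (one_generic T \<longrightarrow> (\<exists>T' \<in> S3. tensor_isomorphic T T'))"
proof (intro conjI allI impI)
  obtain \<alpha> \<beta> where inv_A: "invertible (flatten_A T \<alpha>)" and inv_B: "invertible (flatten_B T \<beta>)"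
    using assms full_rank_imp_invertible unfolding one_A_generic_def one_B_generic_def by blast
  define h where "h = transfer T \<alpha> \<beta>"
  define S where "S = (\<chi> a. h ** T $ a)"
  have inv_h: "invertible h"
    unfolding h_def using inv_A inv_B by (rule invertible_transfer)
  have sym: "S $ a $ b $ c = S $ b $ a $ c" for a b c
    using transfer_symmetric[OF assms(3) inv_A, of \<beta> a b] by (simp add: S_def h_def)
  have "invertible (mat 1 :: complex ^ 'n ^ 'n)"
    unfolding invertible_def using matrix_mul_lid by blast
  then have "tensor_isomorphic T S"
    using tensor_isomorphic_slice_mult[OF inv_h, of "mat 1" T] by (simp add: S_def)
  then show "\<exists>T' \<in> S2_tensor_V. tensor_isomorphic T T'"
    using sym S2_tensor_V_iff by blast
  show "\<exists>T' \<in> S3. tensor_isomorphic T T'" if "one_generic T"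
  proof -
    obtain \<gamma> where inv_C: "invertible (flatten_C T \<gamma>)"
      using \<open>one_generic T\<close> full_rank_imp_invertible
      unfolding one_generic_def one_C_generic_def by blast
    let ?M = "matrix_inv (flatten_A T \<alpha>)"
    \<comment> \<open>This is the inverse of \<open>flatten_B T \<beta>\<close>, which equals
      \<open>h ** flatten_A T \<alpha>\<close>.\<close>
    define K where "K = ?M ** matrix_inv h"
    \<comment> \<open>The factor \<open>matrix_inv h\<close> in \<open>K\<close> absorbs the
      \<open>h\<close> in \<open>S $ d\<close>, which reduces commutation for \<open>S\<close> to
      that for \<open>T\<close>.\<close>
    have SKS: "S $ a ** K ** S $ d = h ** (T $ a ** ?M ** T $ d)" for a d
    proof -
      have "S $ a ** K ** S $ d = h ** (T $ a ** (?M ** ((matrix_inv h ** h) ** T $ d)))"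
        by (simp add: S_def K_def matrix_mul_assoc)
      then show ?thesis
        by (simp add: matrix_inv_mul_matrix[OF inv_h] matrix_mul_assoc)
    qed
    have "S $ a ** K ** S $ d = S $ d ** K ** S $ a" for a d
      unfolding SKS A_Strassen_slices[OF assms(3) inv_A, of a d] ..
    then have "(\<chi> a. S $ a ** (K ** flatten_C S \<gamma>)) \<in> S3"
      by (rule symmetric_slices_S3[OF sym])
    moreover have "flatten_C S \<gamma> = flatten_C T \<gamma> ** transpose h"
      unfolding S_def by (rule flatten_C_slice_mult)
    then have "invertible (K ** flatten_C S \<gamma>)"
      using inv_A inv_h inv_C
      by (simp add: K_def invertible_mult invertible_matrix_inv invertible_transpose)
    then have "tensor_isomorphic T (\<chi> a. S $ a ** (K ** flatten_C S \<gamma>))"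
      using tensor_isomorphic_slice_mult[OF inv_h] by (simp add: S_def)
    ultimately show ?thesis
      by blast
  qed
next
  fix \<alpha> \<beta>
  assume inv: "invertible (flatten_A T \<alpha>) \<and> invertible (flatten_B T \<beta>)"
  let ?h = "transfer T \<alpha> \<beta>"
  have inv_h: "invertible ?h"
    using inv invertible_transfer by blast
  \<comment> \<open>The goal conjugates as \<open>matrix_inv P ** X ** P\<close>, so
    \<open>P\<close> is the inverse of the transfer matrix.\<close>
  have "End_space_B T \<beta>
      = {matrix_inv (matrix_inv ?h) ** X ** matrix_inv ?h | X. X \<in> End_space_A T \<alpha>}"
    using inv End_space_B_conjugate[OF assms(3)] by (simp add: matrix_inv_matrix_inv[OF inv_h])
  then show "\<exists>P :: complex ^ 'n ^ 'n. invertible P \<and>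
      End_space_B T \<beta> = {matrix_inv P ** X ** P | X. X \<in> End_space_A T \<alpha>}"
    using invertible_matrix_inv[OF inv_h] by blast
qed

end
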